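(* Let $F$ be a field, let $F[x]$ be the polynomial ring in the indeterminate $x$ over $F$, and let $R = F[x]/(x^3)$ (the image of $x$ in $R$ is again denoted $x$). Let $S = R\langle q \mid xqx = x,\ qxq = q\rangle$ be the $F$-algebra obtained from $R$ by freely adjoining a generalised inverse $q$ of $x$. Then $x$ is a nilpotent regular element of $S$ which is not unit-regular in $S$.
   Context: All rings and algebras are associative with identity. Equivalently, $S$ is the unital associative $F$-algebra with generators $x,q$ and relations $x^3=0$, $xqx=x$, $qxq=q$. An element $a$ of a ring $A$ is (von Neumann) regular if there is $b\in A$ with $a=aba$; any such $b$ is called an inner inverse of $a$. If $a=aba$ and $b=bab$, then $b$ is called a generalised inverse of $a$. An element $a\in A$ is unit-regular in $A$ if there is an inner inverse $u$ of $a$ in $A$ that is a unit of $A$. *)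

theory Defs
  imports "HOL-Library.Poly_Mapping"
begin

definition is_nilpotent :: "'a::ring_1 \<Rightarrow> bool"
  where "is_nilpotent a \<longleftrightarrow> (\<exists>n. a ^ n = 0)"

definition inner_inverse :: "'a::ring_1 \<Rightarrow> 'a \<Rightarrow> bool"
  where "inner_inverse a b \<longleftrightarrow> a = a * b * a"

definition vn_regular :: "'a::ring_1 \<Rightarrow> bool"
  where "vn_regular a \<longleftrightarrow> (\<exists>b. inner_inverse a b)"

definition ring_unit :: "'a::ring_1 \<Rightarrow> bool"
  where "ring_unit u \<longleftrightarrow> (\<exists>v. u * v = 1 \<and> v * u = 1)"

definition unit_regular :: "'a::ring_1 \<Rightarrow> bool"
  where "unit_regular a \<longleftrightarrow> (\<exists>u. inner_inverse a u \<and> ring_unit u)"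

text \<open>The two-sided ideal generated by a subset of a (noncommutative) ring.\<close>

inductive_set gen_ideal :: "'a::ring_1 set \<Rightarrow> 'a set" for X where
  base: "a \<in> X \<Longrightarrow> a \<in> gen_ideal X"
| zero: "0 \<in> gen_ideal X"
| add: "a \<in> gen_ideal X \<Longrightarrow> b \<in> gen_ideal X \<Longrightarrow> a + b \<in> gen_ideal X"
| mult: "a \<in> gen_ideal X \<Longrightarrow> r * a * s \<in> gen_ideal X"

lemma gen_ideal_minus: "a \<in> gen_ideal X \<Longrightarrow> - a \<in> gen_ideal X"
  using gen_ideal.mult[of a X "-1" 1] by simp

lemma gen_ideal_diff: "a \<in> gen_ideal X \<Longrightarrow> b \<in> gen_ideal X \<Longrightarrow> a - b \<in> gen_ideal X"
  using gen_ideal.add[of a X "- b"] gen_ideal_minus[of b X] by simp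

text \<open>
  The free monoid on two letters, written additively because the product of
  \<^typ>\<open>'a \<Rightarrow>\<^sub>0 'b\<close> is convolution along the addition of \<^typ>\<open>'a\<close>.  Hence
  the type \<open>xq_word \<Rightarrow>\<^sub>0 'f\<close> is the free unital associative algebra
  on the two letters with coefficients in \<open>'f\<close>.
\<close>

datatype xq_letter = LX | LQ

datatype xq_word = Word "xq_letter list"

instantiation xq_word :: monoid_add
begin

definition zero_xq_word :: xq_word where "zero_xq_word = Word []"

fun plus_xq_word :: "xq_word \<Rightarrow> xq_word \<Rightarrow> xq_word" where
  "plus_xq_word (Word u) (Word v) = Word (u @ v)"

instance
proof
  fix a b c :: xq_word
  show "a + b + c = a + (b + c)" by (cases a; cases b; cases c) simp
  show "0 + a = a" by (cases a) (simp add: zero_xq_word_def)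
  show "a + 0 = a" by (cases a) (simp add: zero_xq_word_def)
qed

end

definition free_x :: "xq_word \<Rightarrow>\<^sub>0 'f::field"
  where "free_x = Poly_Mapping.single (Word [LX]) 1"

definition free_q :: "xq_word \<Rightarrow>\<^sub>0 'f::field"
  where "free_q = Poly_Mapping.single (Word [LQ]) 1"

definition relators :: "(xq_word \<Rightarrow>\<^sub>0 'f::field) set"
  where "relators =
    {free_x ^ 3, free_x * free_q * free_x - free_x, free_q * free_x * free_q - free_q}"

text \<open>Only needed to see that the presented algebra is nonzero.\<close>

lemma lookup_times_zero:
  fixes f g :: "xq_word \<Rightarrow>\<^sub>0 'f::field"
  shows "Poly_Mapping.lookup (f * g) 0 = Poly_Mapping.lookup f 0 * Poly_Mapping.lookup g 0"
proof -
  have z: "u + v = 0 \<longleftrightarrow> u = 0 \<and> v = 0" for u v :: xq_word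
    by (cases u; cases v) (auto simp: zero_xq_word_def)
  have "Poly_Mapping.lookup (f * g) 0 = (\<Sum>l. Poly_Mapping.lookup f l * (\<Sum>q. Poly_Mapping.lookup g q when 0 = l + q))"
    by (simp add: times_poly_mapping.rep_eq prod_fun_def)
  also have "\<dots> = (\<Sum>l::xq_word. (Poly_Mapping.lookup f 0 * Poly_Mapping.lookup g 0) when l = 0)"
  proof (rule Sum_any.cong)
    fix l :: xq_word
    have "(\<Sum>q. Poly_Mapping.lookup g q when 0 = l + q) = (\<Sum>q::xq_word. (Poly_Mapping.lookup g 0 when l = 0) when q = 0)"
      by (rule Sum_any.cong) (auto simp: when_def z eq_commute[of 0])
    then show "Poly_Mapping.lookup f l * (\<Sum>q. Poly_Mapping.lookup g q when 0 = l + q)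
        = (Poly_Mapping.lookup f 0 * Poly_Mapping.lookup g 0 when l = 0)"
      by (auto simp: when_def)
  qed
  finally show ?thesis by simp
qed

lemma one_notin_gen_ideal_relators: "1 \<notin> gen_ideal (relators :: (xq_word \<Rightarrow>\<^sub>0 'f::field) set)"
proof
  have x: "Poly_Mapping.lookup (free_x :: xq_word \<Rightarrow>\<^sub>0 'f) 0 = 0" and q: "Poly_Mapping.lookup (free_q :: xq_word \<Rightarrow>\<^sub>0 'f) 0 = 0"
    by (simp_all add: free_x_def free_q_def lookup_single zero_xq_word_def)
  have "Poly_Mapping.lookup a 0 = 0" if "a \<in> gen_ideal (relators :: (xq_word \<Rightarrow>\<^sub>0 'f) set)" for a
    using that
    by induction
      (auto simp: relators_def lookup_times_zero lookup_add lookup_minus x q power3_eq_cube)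
  moreover assume "1 \<in> gen_ideal (relators :: (xq_word \<Rightarrow>\<^sub>0 'f) set)"
  ultimately have "Poly_Mapping.lookup (1 :: xq_word \<Rightarrow>\<^sub>0 'f) 0 = 0" by blast
  then show False by (simp add: lookup_one)
qed

definition rel_cong :: "(xq_word \<Rightarrow>\<^sub>0 'f::field) \<Rightarrow> (xq_word \<Rightarrow>\<^sub>0 'f) \<Rightarrow> bool"
  where "rel_cong a b \<longleftrightarrow> a - b \<in> gen_ideal relators"

lemma equivp_rel_cong: "equivp (rel_cong :: (xq_word \<Rightarrow>\<^sub>0 'f::field) \<Rightarrow> _)"
proof (rule equivpI)
  show "reflp (rel_cong :: (xq_word \<Rightarrow>\<^sub>0 'f) \<Rightarrow> _)" by (simp add: reflp_def rel_cong_def gen_ideal.zero)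
  show "symp (rel_cong :: (xq_word \<Rightarrow>\<^sub>0 'f) \<Rightarrow> _)"
    unfolding symp_def rel_cong_def using gen_ideal_minus by fastforce
  show "transp (rel_cong :: (xq_word \<Rightarrow>\<^sub>0 'f) \<Rightarrow> _)"
    unfolding transp_def rel_cong_def
  proof (intro allI impI)
    fix a b c :: "xq_word \<Rightarrow>\<^sub>0 'f"
    assume "a - b \<in> gen_ideal relators" "b - c \<in> gen_ideal relators"
    then have "(a - b) + (b - c) \<in> gen_ideal relators"
      by (rule gen_ideal.add)
    then show "a - c \<in> gen_ideal relators" by simp
  qed
qed

text \<open>
  The algebra \<open>S\<close> presented by generators \<open>x\<close>, \<open>q\<close> and relations
  \<open>x\<^sup>3 = 0\<close>, \<open>xqx = x\<close>, \<open>qxq = q\<close> over the field \<open>'f\<close>.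
\<close>

quotient_type (overloaded) 'f ginv_alg = "xq_word \<Rightarrow>\<^sub>0 'f::field" / rel_cong
  by (rule equivp_rel_cong)

instantiation ginv_alg :: (field) ring_1
begin

lift_definition zero_ginv_alg :: "'a ginv_alg" is 0 .

lift_definition one_ginv_alg :: "'a ginv_alg" is 1 .

lift_definition plus_ginv_alg :: "'a ginv_alg \<Rightarrow> 'a ginv_alg \<Rightarrow> 'a ginv_alg" is "(+)"
proof -
  fix a b c d :: "xq_word \<Rightarrow>\<^sub>0 'a"
  assume "rel_cong a b" "rel_cong c d"
  then have "(a - b) + (c - d) \<in> gen_ideal relators"
    unfolding rel_cong_def by (rule gen_ideal.add)
  then show "rel_cong (a + c) (b + d)"
    unfolding rel_cong_def by (simp add: algebra_simps)
qed

lift_definition uminus_ginv_alg :: "'a ginv_alg \<Rightarrow> 'a ginv_alg" is uminus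
  unfolding rel_cong_def using gen_ideal_minus by fastforce

lift_definition minus_ginv_alg :: "'a ginv_alg \<Rightarrow> 'a ginv_alg \<Rightarrow> 'a ginv_alg" is "(-)"
proof -
  fix a b c d :: "xq_word \<Rightarrow>\<^sub>0 'a"
  assume "rel_cong a b" "rel_cong c d"
  then have "(a - b) - (c - d) \<in> gen_ideal relators"
    unfolding rel_cong_def by (rule gen_ideal_diff)
  then show "rel_cong (a - c) (b - d)"
    unfolding rel_cong_def by (simp add: algebra_simps)
qed

lift_definition times_ginv_alg :: "'a ginv_alg \<Rightarrow> 'a ginv_alg \<Rightarrow> 'a ginv_alg" is "(*)"
proof -
  fix a b c d :: "xq_word \<Rightarrow>\<^sub>0 'a"
  assume ab: "rel_cong a b" and cd: "rel_cong c d"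
  have "1 * (a - b) * c + b * (c - d) * 1 \<in> gen_ideal relators"
    using ab cd unfolding rel_cong_def by (intro gen_ideal.add gen_ideal.mult)
  then show "rel_cong (a * c) (b * d)"
    unfolding rel_cong_def by (simp add: algebra_simps)
qed

instance
proof
  fix a b c :: "'a ginv_alg"
  show "a + b + c = a + (b + c)"
    by transfer (simp add: rel_cong_def gen_ideal.zero ring_distribs mult.assoc add.assoc add.commute)
  show "a + b = b + a"
    by transfer (simp add: rel_cong_def gen_ideal.zero ring_distribs mult.assoc add.assoc add.commute)
  show "0 + a = a"
    by transfer (simp add: rel_cong_def gen_ideal.zero)
  show "- a + a = 0"
    by transfer (simp add: rel_cong_def gen_ideal.zero)
  show "a - b = a + - b"
    by transfer (simp add: rel_cong_def gen_ideal.zero)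
  show "a * b * c = a * (b * c)"
    by transfer (simp add: rel_cong_def gen_ideal.zero ring_distribs mult.assoc add.assoc add.commute)
  show "1 * a = a"
    by transfer (simp add: rel_cong_def gen_ideal.zero)
  show "a * 1 = a"
    by transfer (simp add: rel_cong_def gen_ideal.zero)
  show "(a + b) * c = a * c + b * c"
    by transfer (simp add: rel_cong_def gen_ideal.zero ring_distribs mult.assoc add.assoc add.commute)
  show "a * (b + c) = a * b + a * c"
    by transfer (simp add: rel_cong_def gen_ideal.zero ring_distribs mult.assoc add.assoc add.commute)
  show "(0 :: 'a ginv_alg) \<noteq> 1"
  proof transfer
    show "\<not> rel_cong (0 :: xq_word \<Rightarrow>\<^sub>0 'a) 1"
      using one_notin_gen_ideal_relators gen_ideal_minus[of "- 1"]
      by (auto simp: rel_cong_def)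
  qed
qed

end

lift_definition S_x :: "'f::field ginv_alg" is free_x .

lift_definition S_q :: "'f::field ginv_alg" is free_q .

end

theory Submission imports Defs begin

text \<open>
  Put \<open>e = xq\<close>.  If \<open>u\<close> were a unit with \<open>xux = x\<close> and inverse \<open>v\<close>, then
  \<open>u(1 - xu)(1 - e)v = 1 - ux\<close>, so some product \<open>a(1 - e)p\<close> would be congruent to \<open>1\<close> modulo
  the left ideal \<open>Sx\<close>.  Modulo \<open>Sx\<close>, the algebra has as basis the reduced words (without factors
  \<open>xxx\<close>, \<open>xqx\<close>, \<open>qxq\<close>) that are empty or end with \<open>q\<close>; in \<open>a(1 - e)p\<close> it suffices to let \<open>a\<close>
  be a combination of reduced words that are empty or end with \<open>x\<close>, and \<open>p\<close> one of basis words
  that are empty or start with \<open>q\<close>.  The longest words of \<open>a(1 - e)p\<close> have to cancel, and this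
  forces the leading part of \<open>p\<close> to be \<open>k\<close> times a shorter part of \<open>p\<close>, for a combination \<open>k\<close> of
  words \<open>qxx\<dots>xx\<close>.  Then \<open>k(1 - e) = k\<close> and \<open>k\<^sup>2 = 0\<close>, so replacing \<open>p\<close> by \<open>(1 - k)p\<close> and \<open>a\<close> by
  \<open>a(1 + (1 - e)k)\<close> keeps the product and shortens \<open>p\<close>: an infinite descent.
\<close>

section \<open>Reduced words\<close>

primrec reduced :: "xq_letter list \<Rightarrow> bool" where
  "reduced [] \<longleftrightarrow> True"
| "reduced (l # w) \<longleftrightarrow>
    take 3 (l # w) \<notin> {[LX, LX, LX], [LX, LQ, LX], [LQ, LX, LQ]} \<and> reduced w"

text \<open>Forbidden factors have three letters, so each one inside the concatenation lies in
  \<open>u @ [a, b]\<close> or in \<open>a # b # v\<close>: an overlap of two letters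
  suffices.\<close>

lemma reduced_append:
  assumes "reduced (u @ [a, b])" and "reduced (a # b # v)"
  shows "reduced (u @ a # b # v)"
  using assms
proof (induction u)
  case (Cons l u)
  then show ?case
    by (cases u; cases "tl u") (auto simp: take_Cons' split: if_splits)
qed simp

lemma reduced_appendD: "reduced (u @ v) \<Longrightarrow> reduced v"
  by (induction u) auto

lemma two_letters_cases [case_names Nil x q xx xq qx qq]:
  assumes "w = [] \<Longrightarrow> thesis" "w = [LX] \<Longrightarrow> thesis" "w = [LQ] \<Longrightarrow> thesis"
    "\<And>v. w = LX # LX # v \<Longrightarrow> thesis" "\<And>v. w = LX # LQ # v \<Longrightarrow> thesis"
    "\<And>v. w = LQ # LX # v \<Longrightarrow> thesis" "\<And>v. w = LQ # LQ # v \<Longrightarrow> thesis"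
  shows thesis
  using assms by (metis neq_Nil_conv xq_letter.exhaust)

text \<open>Left multiplication by a letter on the basis words modulo \<open>Sx\<close>:
  \<open>x\<close> itself and \<open>xxx\<close> vanish, while \<open>xqx\<close> and
  \<open>qxq\<close> shrink to their last letter.\<close>

definition step :: "xq_letter \<Rightarrow> xq_letter list \<Rightarrow> xq_letter list option" where
  "step l w =
    (case l of
       LX \<Rightarrow> if w = [] \<or> take 2 w = [LX, LX] then None
             else if take 2 w = [LQ, LX] then Some (tl w) else Some (LX # w)
     | LQ \<Rightarrow> if take 2 w = [LX, LQ] then Some (tl w) else Some (LQ # w))"

text \<open>
  The normal form of a monomial modulo the left ideal \<open>Sx\<close>; \<open>None\<close> stands for \<open>0\<close>.
\<close>

primrec nf :: "xq_letter list \<Rightarrow> xq_letter list option" where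
  "nf [] = Some []"
| "nf (l # m) = Option.bind (nf m) (step l)"

definition ends_q :: "xq_letter list \<Rightarrow> bool" where
  "ends_q w \<longleftrightarrow> w = [] \<or> last w = LQ"

lemma step_reduced:
  assumes "reduced w" "ends_q w" "step l w = Some w'"
  shows "reduced w' \<and> ends_q w' \<and> length w' \<le> Suc (length w)"
  using assms
  by (cases l; cases w rule: two_letters_cases)
    (auto simp: step_def ends_q_def split: if_splits)

lemma nf_reduced: "nf m = Some w \<Longrightarrow> reduced w \<and> ends_q w \<and> length w \<le> length m"
proof (induction m arbitrary: w)
  case Nil
  then show ?case by (auto simp: ends_q_def)
next
  case (Cons l m)
  then obtain v where "nf m = Some v" "step l v = Some w"
    by (auto simp: bind_eq_Some_conv)
  with Cons.IH[of v] step_reduced[of v l w] show ?case by auto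
qed

lemma nf_id: "reduced w \<Longrightarrow> ends_q w \<Longrightarrow> nf w = Some w"
proof (induction w)
  case (Cons l w)
  moreover have "ends_q w" using Cons.prems by (auto simp: ends_q_def split: if_splits)
  ultimately show ?case
    by (cases l; cases w rule: two_letters_cases)
      (auto simp: step_def ends_q_def split: if_splits)
qed simp

lemma nf_append_cong: "nf v = nf v' \<Longrightarrow> nf (u @ v) = nf (u @ v')"
  by (induction u) auto

lemma nf_append_None: "nf v = None \<Longrightarrow> nf (u @ v) = None"
  by (induction u) auto

lemma nf_snoc_x: "nf (u @ [LX]) = None"
  by (rule nf_append_None) (simp add: step_def)

text \<open>It is checked here and in the next two lemmas that the operators \<open>step\<close>
  satisfy the relations on normal words. This takes the place of a confluence argument for the
  rewriting rules.\<close>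

lemma nf_xxx: "nf (u @ LX # LX # LX # v) = None"
proof (rule nf_append_None, cases "nf v")
  case (Some w)
  with nf_reduced[OF Some] show "nf (LX # LX # LX # v) = None"
    by (cases w rule: two_letters_cases) (auto simp: step_def)
qed simp

lemma nf_xqx: "nf (u @ LX # LQ # LX # v) = nf (u @ LX # v)"
proof (rule nf_append_cong, cases "nf v")
  case (Some w)
  with nf_reduced[OF Some] show "nf (LX # LQ # LX # v) = nf (LX # v)"
    by (cases w rule: two_letters_cases) (auto simp: step_def)
qed simp

lemma nf_qxq: "nf (u @ LQ # LX # LQ # v) = nf (u @ LQ # v)"
proof (rule nf_append_cong, cases "nf v")
  case (Some w)
  with nf_reduced[OF Some] show "nf (LQ # LX # LQ # v) = nf (LQ # v)"
    by (cases w rule: two_letters_cases) (auto simp: step_def)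
qed simp

section \<open>Coefficients modulo the left ideal generated by \<open>x\<close>\<close>

lemma poly_mapping_additive_induct [case_names single add]:
  fixes a :: "'a \<Rightarrow>\<^sub>0 'b::ab_group_add"
  assumes "\<And>m c. P (Poly_Mapping.single m c)"
    and "\<And>a b. P a \<Longrightarrow> P b \<Longrightarrow> P (a + b)"
  shows "P a"
proof -
  have "P (\<Sum>m\<in>A. Poly_Mapping.single m (Poly_Mapping.lookup a m))" if "finite A" for A
    \<comment> \<open>A \<open>single\<close> with coefficient 0 is the zero mapping, which starts
      the induction.\<close>
    using that assms(1)[of _ 0] by induction (auto intro: assms)
  moreover have "(\<Sum>m\<in>Poly_Mapping.keys a. Poly_Mapping.single m (Poly_Mapping.lookup a m)) = a"
    by (rule poly_mapping_eqI)
      (simp add: lookup_sum lookup_single when_def sum.delta' in_keys_iff)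
  ultimately show ?thesis by (metis finite_keys)
qed

fun word_letters :: "xq_word \<Rightarrow> xq_letter list" where
  "word_letters (Word m) = m"

text \<open>A linear functional meant to descend to the quotient and to separate the basis words
  modulo \<open>Sx\<close>; \<open>None\<close> never equals \<open>Some y\<close>, so vanishing
  monomials drop out.\<close>

definition free_coeff :: "xq_letter list \<Rightarrow> (xq_word \<Rightarrow>\<^sub>0 'f::field) \<Rightarrow> 'f" where
  "free_coeff y a = (\<Sum>m\<in>Poly_Mapping.keys a.
     Poly_Mapping.lookup a m * of_bool (nf (word_letters m) = Some y))"

lemma free_coeff_superset:
  assumes "finite A" "Poly_Mapping.keys a \<subseteq> A"
  shows "free_coeff y a =
    (\<Sum>m\<in>A. Poly_Mapping.lookup a m * of_bool (nf (word_letters m) = Some y))"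
  unfolding free_coeff_def using assms
  by (intro sum.mono_neutral_left) (auto simp: in_keys_iff)

lemma free_coeff_add: "free_coeff y (a + b) = free_coeff y a + free_coeff y b"
proof -
  let ?A = "Poly_Mapping.keys a \<union> Poly_Mapping.keys b"
  have "free_coeff y c = (\<Sum>m\<in>?A. Poly_Mapping.lookup c m * of_bool (nf (word_letters m) = Some y))"
    if "c \<in> {a, b, a + b}" for c
    using that by (intro free_coeff_superset) (auto dest: subsetD[OF Poly_Mapping.keys_add])
  then show ?thesis by (simp add: lookup_add ring_distribs sum.distrib)
qed

lemma free_coeff_0: "free_coeff y 0 = 0"
  by (simp add: free_coeff_def)

lemma free_coeff_diff: "free_coeff y (a - b) = free_coeff y a - free_coeff y b"
  using free_coeff_add[of y "a - b" b] by simp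

lemma free_coeff_single:
  "free_coeff y (Poly_Mapping.single (Word m) c) = c * of_bool (nf m = Some y)"
  by (cases "c = 0") (auto simp: free_coeff_def)

text \<open>The context \<open>r\<close>, \<open>s\<close> is arbitrary so that multiplications
  within the ideal can be absorbed into it. By additivity both may be taken to be monomials, where
  \<open>nf\<close> respects the relations.\<close>

lemma free_coeff_ideal:
  fixes a :: "xq_word \<Rightarrow>\<^sub>0 'f::field"
  assumes "a \<in> gen_ideal relators"
  shows "free_coeff y (r * a * s) = 0"
  using assms
proof (induction a arbitrary: r s)
  case (base a)
  show ?case
  proof (induction r rule: poly_mapping_additive_induct)
    case (single m c)
    show ?case
    proof (induction s rule: poly_mapping_additive_induct)
      case (single n d)
      obtain u v where "m = Word u" "n = Word v" by (cases m; cases n)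
      then show ?case using base
        by (auto simp: relators_def power3_eq_cube free_x_def free_q_def mult_single
            ring_distribs free_coeff_single free_coeff_diff nf_xxx nf_xqx nf_qxq)
    qed (simp add: ring_distribs free_coeff_add)
  qed (simp add: ring_distribs free_coeff_add)
next
  case (mult a r' s')
  then show ?case using mult.IH[of "r * r'" "s' * s"] by (simp add: mult.assoc)
qed (simp_all add: ring_distribs free_coeff_add free_coeff_0)

lift_definition coeff :: "xq_letter list \<Rightarrow> 'f::field ginv_alg \<Rightarrow> 'f" is free_coeff
proof -
  fix y and a b :: "xq_word \<Rightarrow>\<^sub>0 'f"
  assume "rel_cong a b"
  then show "free_coeff y a = free_coeff y b"
    using free_coeff_ideal[of "a - b" y 1 1] by (simp add: rel_cong_def free_coeff_diff)
qed

section \<open>Monomials of the algebra and their rewriting by the relations\<close>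

lift_definition monomial :: "'f \<Rightarrow> xq_letter list \<Rightarrow> 'f::field ginv_alg"
  is "\<lambda>c m. Poly_Mapping.single (Word m) c" .

lemma coeff_add: "coeff y (a + b) = coeff y a + coeff y b"
  by transfer (rule free_coeff_add)

lemma coeff_diff: "coeff y (a - b) = coeff y a - coeff y b"
  using coeff_add[of y "a - b" b] by simp

lemma coeff_sum: "coeff y (sum f A) = (\<Sum>i\<in>A. coeff y (f i))"
proof -
  have "coeff y (0 :: 'f::field ginv_alg) = 0" by transfer (rule free_coeff_0)
  then show ?thesis by (induction A rule: infinite_finite_induct) (auto simp: coeff_add)
qed

lemma coeff_monomial: "coeff y (monomial c m) = c * of_bool (nf m = Some y)"
  by transfer (rule free_coeff_single)

lemma monomial_mult: "monomial c u * monomial d v = monomial (c * d) (u @ v)"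
  by transfer (simp add: mult_single rel_cong_def gen_ideal.zero)

lemma monomial_add: "monomial (c + d) u = monomial c u + monomial d u"
  by transfer (simp add: single_add rel_cong_def gen_ideal.zero)

lemma monomial_0 [simp]: "monomial 0 u = 0"
  by transfer (simp add: rel_cong_def gen_ideal.zero)

lemma monomial_Nil: "monomial 1 [] = 1"
  by transfer (simp add: rel_cong_def gen_ideal.zero single_one flip: zero_xq_word_def)

lemma S_x_eq: "S_x = monomial 1 [LX]" and S_q_eq: "S_q = monomial 1 [LQ]"
  by (transfer, simp add: free_x_def free_q_def rel_cong_def gen_ideal.zero)+

lemma rel_cong_relator: "a - b \<in> relators \<Longrightarrow> rel_cong a b"
  by (simp add: rel_cong_def gen_ideal.base)

lemma S_x_cubed: "(S_x :: 'f::field ginv_alg) * S_x * S_x = 0"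
  by transfer (rule rel_cong_relator, simp add: relators_def power3_eq_cube)

lemma S_xqx: "(S_x :: 'f::field ginv_alg) * S_q * S_x = S_x"
  by transfer (rule rel_cong_relator, simp add: relators_def)

lemma S_qxq: "(S_q :: 'f::field ginv_alg) * S_x * S_q = S_q"
  by transfer (rule rel_cong_relator, simp add: relators_def)

lemma monomial_split3:
  "monomial c (u @ a # b # d # v) =
    monomial c u * (monomial 1 [a] * monomial 1 [b] * monomial 1 [d]) * monomial 1 v"
  by (simp add: monomial_mult)

lemma monomial_xxx: "monomial c (u @ LX # LX # LX # v) = 0"
  by (simp only: monomial_split3 S_x_eq[symmetric] S_x_cubed) simp

lemma monomial_xqx: "monomial c (u @ LX # LQ # LX # v) = monomial c (u @ LX # v)"
  by (simp only: monomial_split3 S_x_eq[symmetric] S_q_eq[symmetric] S_xqx)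
    (simp add: S_x_eq monomial_mult)

lemma monomial_qxq: "monomial c (u @ LQ # LX # LQ # v) = monomial c (u @ LQ # v)"
  by (simp only: monomial_split3 S_x_eq[symmetric] S_q_eq[symmetric] S_qxq)
    (simp add: S_q_eq monomial_mult)

lemmas monomial_relations =
  monomial_xxx[where u = "[]", simplified] monomial_xqx[where u = "[]", simplified]
  monomial_qxq[where u = "[]", simplified]

section \<open>The left ideal generated by \<open>x\<close>\<close>

definition left_ideal_x :: "'f::field ginv_alg set" where
  "left_ideal_x = range (\<lambda>k. k * S_x)"

lemma left_ideal_x_mult: "a \<in> left_ideal_x \<Longrightarrow> r * a \<in> left_ideal_x"
  by (force simp: left_ideal_x_def simp flip: mult.assoc)

lemma left_ideal_x_add: "a \<in> left_ideal_x \<Longrightarrow> b \<in> left_ideal_x \<Longrightarrow> a + b \<in> left_ideal_x"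
  by (force simp: left_ideal_x_def simp flip: distrib_right)

lemma left_ideal_x_0: "0 \<in> left_ideal_x"
  by (force simp: left_ideal_x_def intro: image_eqI[where x = 0])

lemma left_ideal_x_diff: "a \<in> left_ideal_x \<Longrightarrow> b \<in> left_ideal_x \<Longrightarrow> a - b \<in> left_ideal_x"
  by (force simp: left_ideal_x_def simp flip: left_diff_distrib)

lemma left_ideal_x_sum: "(\<And>i. i \<in> A \<Longrightarrow> f i \<in> left_ideal_x) \<Longrightarrow> sum f A \<in> left_ideal_x"
  by (induction A rule: infinite_finite_induct) (auto simp: left_ideal_x_0 left_ideal_x_add)

lemma monomial_snoc_x: "monomial c (u @ [LX]) \<in> left_ideal_x"
  unfolding left_ideal_x_def S_x_eq by (rule image_eqI[where x = "monomial c u"]) (simp_all add: monomial_mult)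

lemma ginv_alg_induct [case_names monomial add]:
  assumes "\<And>c m. P (monomial c m)" and "\<And>a b. P a \<Longrightarrow> P b \<Longrightarrow> P (a + b)"
  shows "P a"
  using assms
proof (transfer fixing: )
  fix P :: "(xq_word \<Rightarrow>\<^sub>0 'a) \<Rightarrow> bool" and a
  assume "\<And>c m. P (Poly_Mapping.single (Word m) c)" and "\<And>a b. P a \<Longrightarrow> P b \<Longrightarrow> P (a + b)"
  then show "P a"
    by (induction a rule: poly_mapping_additive_induct) (metis xq_word.exhaust)+
qed

text \<open>A monomial ending with \<open>x\<close> has normal form \<open>None\<close>, so the
  functionals \<open>coeff y\<close> factor through the quotient by \<open>Sx\<close>.\<close>

lemma coeff_left_ideal_x:
  assumes "a \<in> left_ideal_x"
  shows "coeff y a = 0"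
proof -
  obtain k where "a = k * S_x" using assms by (auto simp: left_ideal_x_def)
  moreover have "coeff y (k * S_x) = 0"
    by (induction k rule: ginv_alg_induct)
      (simp_all add: S_x_eq monomial_mult coeff_monomial nf_snoc_x ring_distribs coeff_add)
  ultimately show ?thesis by simp
qed

section \<open>Normal forms of elements\<close>

text \<open>The idempotent complementary to \<open>xq\<close>. It satisfies
  \<open>coidem * x = 0\<close> and \<open>q * coidem = 0\<close>, which is why normal words start
  with \<open>q\<close> on its right and end with \<open>x\<close> on its left.\<close>

definition coidem :: "'f::field ginv_alg" where
  "coidem = 1 - S_x * S_q"

lemma coidem_eq: "coidem = monomial 1 [] - monomial 1 [LX, LQ]"
  by (simp add: coidem_def S_x_eq S_q_eq monomial_mult monomial_Nil)

lemma coidem_x: "coidem * monomial c (LX # m) = 0"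
  by (simp add: coidem_eq left_diff_distrib monomial_mult monomial_relations)

lemma q_coidem: "monomial c (m @ [LQ]) * coidem = 0"
  by (simp add: coidem_eq right_diff_distrib monomial_mult monomial_qxq[where v = "[]"])

text \<open>The correction term ends with \<open>xxxq\<close>, which is zero.\<close>

lemma monomial_xx_coidem: "monomial c (m @ [LX, LX]) * coidem = monomial c (m @ [LX, LX])"
  by (simp add: coidem_eq right_diff_distrib monomial_mult monomial_xxx)

definition ends_x :: "xq_letter list \<Rightarrow> bool" where
  "ends_x w \<longleftrightarrow> w = [] \<or> last w = LX"

definition starts_q :: "xq_letter list \<Rightarrow> bool" where
  "starts_q w \<longleftrightarrow> w = [] \<or> hd w = LQ"

text \<open>On nonempty words each branch of \<open>step\<close> is an identity of the algebra. On
  the empty word \<open>step\<close> drops \<open>x\<close>, which is legitimate only modulo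
  \<open>Sx\<close>.\<close>

lemma monomial_step:
  assumes "w \<noteq> []"
  shows "monomial c (l # w) = (case step l w of None \<Rightarrow> 0 | Some v \<Rightarrow> monomial c v)"
  using assms
  by (cases l; cases w rule: two_letters_cases)
    (auto simp: step_def monomial_relations monomial_xqx[where u = "[]" and v = "[]", simplified])

text \<open>Prepending a letter is a left multiplication and so preserves \<open>Sx\<close>;
  congruences therefore pass from \<open>m\<close> to \<open>l # m\<close>.\<close>

lemma monomial_nf:
  "case nf m of None \<Rightarrow> monomial c m \<in> left_ideal_x
   | Some w \<Rightarrow> monomial c m - monomial c w \<in> left_ideal_x"
proof (induction m)
  case Nil
  then show ?case by (simp add: left_ideal_x_0)
next
  case (Cons l m)
  have *: "monomial c (l # v) = monomial 1 [l] * monomial c v" for v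
    by (simp add: monomial_mult)
  show ?case
  proof (cases "nf m")
    case None
    with Cons show ?thesis by (simp add: *[of m] left_ideal_x_mult)
  next
    case (Some w)
    with Cons have "monomial c (l # m) - monomial c (l # w) \<in> left_ideal_x"
      by (simp add: *[of m] *[of w] left_ideal_x_mult flip: right_diff_distrib)
    moreover have "case step l w of None \<Rightarrow> monomial c (l # w) \<in> left_ideal_x
        | Some v \<Rightarrow> monomial c (l # w) = monomial c v"
    proof (cases "w = []")
      case True
      then show ?thesis using monomial_snoc_x[of c "[]"] by (cases l) (auto simp: step_def)
    next
      case False
      then show ?thesis
        by (cases "step l w") (simp_all add: monomial_step left_ideal_x_0)
    qed
    ultimately show ?thesis using Some left_ideal_x_add
      by (cases "step l w") fastforce+
  qed
qed

text \<open>Here the equalities are exact. At the empty word \<open>x\<close> is kept and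
  \<open>q * coidem = 0\<close> removes \<open>q\<close>; on nonempty words \<open>step\<close>
  leaves the last letter alone.\<close>

lemma monomial_right_nf:
  "monomial c m * coidem = 0 \<or>
   (\<exists>w. reduced w \<and> ends_x w \<and> monomial c m * coidem = monomial c w * coidem)"
proof (induction m)
  case Nil
  show ?case by (intro disjI2 exI[of _ "[]"]) (simp add: ends_x_def)
next
  case (Cons l m)
  have *: "monomial c (l # v) * coidem = monomial 1 [l] * (monomial c v * coidem)" for v
    by (simp add: monomial_mult flip: mult.assoc)
  show ?case
  proof (cases "monomial c m * coidem = 0")
    case True
    then show ?thesis by (simp add: *)
  next
    case False
    with Cons obtain w where w: "reduced w" "ends_x w"
      "monomial c m * coidem = monomial c w * coidem" by blast
    then have eq: "monomial c (l # m) * coidem = monomial c (l # w) * coidem"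
      by (simp add: *)
    show ?thesis
    proof (cases "w = []")
      case True
      show ?thesis
      proof (cases l)
        case LX
        with True eq show ?thesis
          by (intro disjI2 exI[of _ "[LX]"]) (simp add: ends_x_def)
      next
        case LQ
        with True eq q_coidem[of c "[]"] show ?thesis by simp
      qed
    next
      case False
      show ?thesis
      proof (cases "step l w")
        case None
        with False eq show ?thesis by (simp add: monomial_step)
      next
        case (Some v)
        have "reduced v \<and> ends_x v"
          using w(1,2) False Some
          by (cases l; cases w rule: two_letters_cases)
            (auto simp: step_def ends_x_def split: if_splits)
        with Some False eq show ?thesis by (auto simp: monomial_step)
      qed
    qed
  qed
qed

section \<open>Finite linear combinations of words\<close>

definition lin :: "(xq_letter list \<Rightarrow> 'f) \<Rightarrow> 'f::field ginv_alg" where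
  "lin p = (\<Sum>m | p m \<noteq> 0. monomial (p m) m)"

lemma lin_superset:
  assumes "finite A" "{m. p m \<noteq> 0} \<subseteq> A"
  shows "lin p = (\<Sum>m\<in>A. monomial (p m) m)"
  unfolding lin_def using assms by (intro sum.mono_neutral_left) auto

lemma finite_support_add:
  fixes p p' :: "'a \<Rightarrow> 'b::monoid_add"
  assumes "finite {m. p m \<noteq> 0}" "finite {m. p' m \<noteq> 0}"
  shows "finite {m. p m + p' m \<noteq> 0}"
proof (rule finite_subset)
  show "{m. p m + p' m \<noteq> 0} \<subseteq> {m. p m \<noteq> 0} \<union> {m. p' m \<noteq> 0}" by auto
qed (use assms in simp)

lemma lin_add:
  assumes "finite {m. p m \<noteq> 0}" "finite {m. p' m \<noteq> 0}"
  shows "lin (\<lambda>m. p m + p' m) = lin p + lin p'"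
proof -
  let ?A = "{m. p m \<noteq> 0} \<union> {m. p' m \<noteq> 0}"
  have "lin f = (\<Sum>m\<in>?A. monomial (f m) m)" if "f \<in> {p, p', \<lambda>m. p m + p' m}" for f
    using that assms by (intro lin_superset) auto
  then show ?thesis by (simp add: monomial_add sum.distrib)
qed

lemma lin_single: "lin (\<lambda>m. if m = w then c else 0) = monomial c w"
  by (subst lin_superset[of "{w}"]) auto

lemma right_normal_form:
  "\<exists>r. finite {w. r w \<noteq> 0} \<and> (\<forall>w. r w \<noteq> 0 \<longrightarrow> reduced w \<and> ends_x w)
     \<and> a * coidem = lin r * coidem"
proof (induction a rule: ginv_alg_induct)
  case (monomial c m)
  show ?case
  proof (cases "monomial c m * coidem = 0")
    case True
    then show ?thesis by (intro exI[of _ "\<lambda>_. 0"]) (simp add: lin_def)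
  next
    case False
    then obtain w where w: "reduced w" "ends_x w"
      and eq: "monomial c m * coidem = monomial c w * coidem"
      using monomial_right_nf by blast
    let ?r = "\<lambda>v. if v = w then c else 0"
    have "finite {v. ?r v \<noteq> 0}" by (rule finite_subset[of _ "{w}"]) auto
    moreover have "monomial c m * coidem = lin ?r * coidem"
      by (simp only: lin_single eq)
    moreover have "\<forall>v. ?r v \<noteq> 0 \<longrightarrow> reduced v \<and> ends_x v" using w by simp
    ultimately show ?thesis by (intro exI[of _ ?r] conjI)
  qed
next
  case (add a b)
  from add.IH obtain r r' where fin: "finite {w. r w \<noteq> 0}" "finite {w. r' w \<noteq> 0}"
    and supp: "\<forall>w. r w \<noteq> 0 \<longrightarrow> reduced w \<and> ends_x w"
      "\<forall>w. r' w \<noteq> 0 \<longrightarrow> reduced w \<and> ends_x w"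
    and eq: "a * coidem = lin r * coidem" "b * coidem = lin r' * coidem"
    by (elim exE conjE) (rule that)
  have "\<forall>w. r w + r' w \<noteq> 0 \<longrightarrow> reduced w \<and> ends_x w" using supp by force
  with finite_support_add[OF fin] eq show ?case
    by (intro exI[of _ "\<lambda>w. r w + r' w"]) (simp add: lin_add[OF fin] ring_distribs)
qed

text \<open>The length filtration that measures the descent. The bound is strict so that the length
  of a longest word can serve as the next, smaller index.\<close>

inductive_set length_less :: "nat \<Rightarrow> 'f::field ginv_alg set" for n where
  zero: "0 \<in> length_less n"
| monomial: "length m < n \<Longrightarrow> monomial c m \<in> length_less n"
| add: "a \<in> length_less n \<Longrightarrow> b \<in> length_less n \<Longrightarrow> a + b \<in> length_less n"

lemma length_less_sum: "(\<And>i. i \<in> A \<Longrightarrow> f i \<in> length_less n) \<Longrightarrow> sum f A \<in> length_less n"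
  by (induction A rule: infinite_finite_induct) (auto intro: length_less.intros)

lemma length_less_mono: "a \<in> length_less n \<Longrightarrow> n \<le> n' \<Longrightarrow> a \<in> length_less n'"
  by (induction rule: length_less.induct) (auto intro: length_less.intros)

lemma length_less_exhausts: "\<exists>n. a \<in> length_less n"
proof (induction a rule: ginv_alg_induct)
  case (monomial c m)
  then show ?case by (intro exI[of _ "Suc (length m)"] length_less.monomial) simp
next
  case (add a b)
  then obtain n n' where "a \<in> length_less n" "b \<in> length_less n'" by blast
  then show ?case
    by (intro exI[of _ "max n n'"] length_less.add) (auto elim: length_less_mono)
qed

text \<open>Reduction by \<open>nf\<close> never lengthens a word, so the bound \<open>n\<close>
  survives. Reduced words starting with \<open>x\<close> are discarded because
  \<open>coidem * x = 0\<close>.\<close>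

lemma left_normal_form:
  assumes "a \<in> length_less n"
  shows "\<exists>p. finite {z. p z \<noteq> 0}
    \<and> (\<forall>z. p z \<noteq> 0 \<longrightarrow> reduced z \<and> ends_q z \<and> starts_q z \<and> length z < n)
    \<and> coidem * (a - lin p) \<in> left_ideal_x"
  using assms
proof induction
  case zero
  show ?case by (intro exI[of _ "\<lambda>_. 0"]) (simp add: lin_def left_ideal_x_0)
next
  case (monomial m c)
  have zero: ?case if "coidem * monomial c m \<in> left_ideal_x"
    using that by (intro exI[of _ "\<lambda>_. 0"]) (simp add: lin_def)
  show ?case
  proof (cases "nf m")
    case None
    with zero show ?thesis using monomial_nf[of c m] left_ideal_x_mult by auto
  next
    case (Some w)
    note w = nf_reduced[OF Some]
    have "coidem * (monomial c m - monomial c w) \<in> left_ideal_x"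
      using Some monomial_nf[of c m] left_ideal_x_mult by auto
    moreover from this have "coidem * monomial c m \<in> left_ideal_x" if "\<not> starts_q w"
      using that by (cases w; cases "hd w") (auto simp: right_diff_distrib starts_q_def coidem_x)
    moreover have ?thesis
      if "starts_q w" and cong: "coidem * (monomial c m - monomial c w) \<in> left_ideal_x"
    proof -
      let ?p = "\<lambda>v. if v = w then c else 0"
      have "finite {v. ?p v \<noteq> 0}" by (rule finite_subset[of _ "{w}"]) auto
      moreover have "coidem * (monomial c m - lin ?p) \<in> left_ideal_x"
        using cong by (simp only: lin_single)
      moreover have "\<forall>z. ?p z \<noteq> 0 \<longrightarrow> reduced z \<and> ends_q z \<and> starts_q z \<and> length z < n"
        using w that monomial by simp
      ultimately show ?thesis by (intro exI[of _ ?p] conjI)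
    qed
    ultimately show ?thesis using zero by blast
  qed
next
  case (add a b)
  from add.IH obtain p p' where fin: "finite {z. p z \<noteq> 0}" "finite {z. p' z \<noteq> 0}"
    and supp: "\<forall>z. p z \<noteq> 0 \<longrightarrow> reduced z \<and> ends_q z \<and> starts_q z \<and> length z < n"
      "\<forall>z. p' z \<noteq> 0 \<longrightarrow> reduced z \<and> ends_q z \<and> starts_q z \<and> length z < n"
    and eq: "coidem * (a - lin p) \<in> left_ideal_x" "coidem * (b - lin p') \<in> left_ideal_x"
    by (elim exE conjE) (rule that)
  have "\<forall>z. p z + p' z \<noteq> 0 \<longrightarrow> reduced z \<and> ends_q z \<and> starts_q z \<and> length z < n"
    using supp by force
  moreover have "coidem * (a + b - lin (\<lambda>z. p z + p' z)) \<in> left_ideal_x"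
    using left_ideal_x_add[OF eq] by (simp only: lin_add[OF fin]) (simp add: algebra_simps)
  ultimately show ?case
    using finite_support_add[OF fin] by (intro exI[of _ "\<lambda>z. p z + p' z"] conjI)
qed

section \<open>Cancellation of leading terms\<close>

text \<open>A monomial in such a word absorbs \<open>coidem\<close> on its right.\<close>

definition double :: "xq_letter list \<Rightarrow> bool" where
  "double w \<longleftrightarrow> (\<exists>u. w = u @ [LX, LX])"

text \<open>For a normal word \<open>z\<close> starting with \<open>q\<close>, this says that
  \<open>xxz\<close> contains no factor \<open>xqx\<close>.\<close>

definition strong :: "xq_letter list \<Rightarrow> bool" where
  "strong z \<longleftrightarrow> z = [LQ] \<or> (\<exists>v. z = LQ # LQ # v)"

text \<open>
  \<open>pairing w z y\<close> is the coefficient of \<open>y\<close> in \<open>w(1 - xq)z\<close> modulo \<open>Sx\<close>.  For normal \<open>w\<close>, \<open>z\<close>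
  this product is led by \<open>-wxqz\<close> if \<open>w\<close> is not double, is the word \<open>wz\<close> if \<open>w\<close> is double and \<open>z\<close>
  strong, and vanishes otherwise.
\<close>

definition pairing :: "xq_letter list \<Rightarrow> xq_letter list \<Rightarrow> xq_letter list \<Rightarrow> 'f::field" where
  "pairing w z y = of_bool (nf (w @ z) = Some y) - of_bool (nf (w @ LX # LQ # z) = Some y)"

lemma coeff_lin_coidem_lin:
  fixes r p :: "xq_letter list \<Rightarrow> 'f::field"
  shows "coeff y (lin r * coidem * lin p) =
    (\<Sum>w | r w \<noteq> 0. \<Sum>z | p z \<noteq> 0. r w * p z * pairing w z y)"
proof -
  have "lin r * coidem * lin p =
    (\<Sum>w | r w \<noteq> 0. \<Sum>z | p z \<noteq> 0. monomial (r w) w * coidem * monomial (p z) z)"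
    by (simp only: lin_def sum_distrib_right) (simp only: sum_distrib_left)
  moreover have "coeff y (monomial c w * coidem * monomial d z) = c * d * pairing w z y"
    for c d :: 'f and w z
    by (simp add: coidem_eq ring_distribs monomial_mult coeff_diff coeff_monomial pairing_def)
  ultimately show ?thesis by (simp add: coeff_sum)
qed

lemma not_double_cases:
  assumes "ends_x w" "\<not> double w"
  obtains "w = []" | "w = [LX]" | u where "w = u @ [LQ, LX]"
proof (cases w rule: rev_cases)
  case (snoc v l)
  with assms have "w = v @ [LX]" by (simp add: ends_x_def)
  with assms that show ?thesis
    by (cases v rule: rev_cases) (auto simp: double_def intro: xq_letter.exhaust)
qed (use that in blast)

text \<open>A normal word cannot continue \<open>qx\<close> by \<open>q\<close>, and it cannot stop
  there because it ends with \<open>q\<close>.\<close>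

lemma not_strong_cases:
  assumes "reduced z" "ends_q z" "starts_q z" "\<not> strong z"
  obtains "z = []" | v where "z = LQ # LX # LX # v"
proof (cases z rule: two_letters_cases)
  case (qx v)
  with assms that show ?thesis by (cases v; cases "hd v") (auto simp: ends_q_def)
qed (use assms that in \<open>auto simp: starts_q_def strong_def\<close>)

text \<open>As \<open>w\<close> ends with at most one \<open>x\<close>, the inserted
  \<open>x\<close> creates no \<open>xxx\<close>; as \<open>z\<close> is empty or starts with
  \<open>q\<close>, the inserted \<open>q\<close> creates no \<open>xqx\<close>.\<close>

lemma nf_single_append:
  assumes "reduced w" "ends_x w" "\<not> double w" "reduced z" "ends_q z" "starts_q z"
  shows "nf (w @ LX # LQ # z) = Some (w @ LX # LQ # z)"
proof (rule nf_id)
  have xqz: "reduced (LX # LX # LQ # z)"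
    using assms(4,6) by (cases z rule: two_letters_cases) (auto simp: starts_q_def)
  show "reduced (w @ LX # LQ # z)"
    using assms(2,3)
  proof (cases rule: not_double_cases)
    case (3 u)
    then have "reduced (u @ LQ # LX # LX # LQ # z)"
      using assms(1) xqz by (simp add: reduced_append)
    with 3 show ?thesis by simp
  qed (use xqz in auto)
  show "ends_q (w @ LX # LQ # z)"
    using assms(5) by (auto simp: ends_q_def)
qed

lemma nf_double_append:
  assumes "reduced w" "double w" "reduced z" "ends_q z" "strong z"
  shows "nf (w @ z) = Some (w @ z)"
proof (rule nf_id)
  obtain u where w: "w = u @ [LX, LX]" using assms(2) by (auto simp: double_def)
  have "reduced (LX # LX # z)" using assms(3,5) by (auto simp: strong_def)
  then show "reduced (w @ z)" using assms(1) reduced_append by (simp add: w)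
  show "ends_q (w @ z)" using assms(4,5) by (auto simp: ends_q_def strong_def)
qed

text \<open>The other product \<open>w @ z\<close> may reduce but never grows, so it cannot yield a
  word as long as \<open>y\<close>.\<close>

lemma pairing_single:
  assumes "reduced w" "ends_x w" "\<not> double w" "reduced z" "ends_q z" "starts_q z"
    and "length w + length z < length y"
  shows "pairing w z y = - of_bool (y = w @ LX # LQ # z)"
  using assms nf_reduced[of "w @ z" y] by (auto simp: pairing_def nf_single_append)

lemma pairing_double_strong:
  assumes "reduced w" "double w" "reduced z" "ends_q z" "strong z"
  shows "pairing w z y = of_bool (y = w @ z)"
proof -
  obtain u where "w = u @ [LX, LX]" using assms(2) by (auto simp: double_def)
  then have "nf (w @ LX # LQ # z) = None" by (simp add: nf_xxx)
  with assms show ?thesis by (auto simp: pairing_def nf_double_append)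
qed

text \<open>For empty \<open>z\<close> the product \<open>w @ z\<close> ends with \<open>x\<close>;
  otherwise \<open>xx\<close> meets \<open>qxx\<close> and collapses to \<open>xxx\<close>.\<close>

lemma pairing_double_weak:
  assumes "double w" "reduced z" "ends_q z" "starts_q z" "\<not> strong z"
  shows "pairing w z y = 0"
proof -
  obtain u where w: "w = u @ [LX, LX]" using assms(1) by (auto simp: double_def)
  from assms(2-5) have "nf (w @ z) = None"
  proof (cases rule: not_strong_cases)
    case 1
    then show ?thesis using nf_snoc_x[of "u @ [LX]"] by (simp add: w)
  next
    case (2 v)
    then show ?thesis using nf_xqx[of "u @ [LX]" "LX # v"] by (simp add: w nf_xxx)
  qed
  then show ?thesis by (simp add: pairing_def w nf_xxx)
qed

lemma exists_longest:
  assumes "finite {a. P a}" "P b"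
  shows "\<exists>a. P a \<and> (\<forall>b. P b \<longrightarrow> length b \<le> length a)"
proof -
  let ?A = "{a. P a}"
  have "Max (length ` ?A) \<in> length ` ?A" using assms by (intro Max_in) auto
  then obtain a where a: "P a" "length a = Max (length ` ?A)" by auto
  then have "length b \<le> length a" if "P b" for b
    using assms(1) that by simp
  with a show ?thesis by blast
qed

text \<open>The longest words \<open>w x q z\<close> (\<open>w\<close> not double) must cancel
  against the longest words \<open>w z\<close> (\<open>w\<close> double, \<open>z\<close> strong).
  Comparing the two factorisations splits each longest word of \<open>p\<close> as
  \<open>t @ z'\<close>, with \<open>z'\<close> a longest strong word of \<open>p\<close> and a
  coefficient ratio that depends on \<open>t\<close> only.\<close>

lemma leading_cancellation:
  fixes r p :: "xq_letter list \<Rightarrow> 'f::field"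
  assumes fin_r: "finite {w. r w \<noteq> 0}" and fin_p: "finite {z. p z \<noteq> 0}"
    and r: "\<And>w. r w \<noteq> 0 \<Longrightarrow> reduced w \<and> ends_x w"
    and p: "\<And>z. p z \<noteq> 0 \<Longrightarrow> reduced z \<and> ends_q z \<and> starts_q z"
    and total: "\<And>y. (\<Sum>w | r w \<noteq> 0. \<Sum>z | p z \<noteq> 0. r w * p z * pairing w z y) = of_bool (y = [])"
  obtains w0 z0 N where
    "r w0 \<noteq> 0" "p z0 \<noteq> 0" "\<And>z. p z \<noteq> 0 \<Longrightarrow> length z \<le> length z0"
    "N < length z0" "\<And>z. p z \<noteq> 0 \<Longrightarrow> strong z \<Longrightarrow> length z \<le> N"
    "\<And>z. p z \<noteq> 0 \<Longrightarrow> length z = length z0 \<Longrightarrow>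
      \<exists>t z'. z = t @ z' \<and> length z' = N \<and> strong z' \<and> p z' \<noteq> 0 \<and> r (w0 @ LX # LQ # t) \<noteq> 0"
    "\<And>t z'. r (w0 @ LX # LQ # t) \<noteq> 0 \<Longrightarrow> p z' \<noteq> 0 \<Longrightarrow> strong z' \<Longrightarrow> length z' = N \<Longrightarrow>
      length t + N = length z0 \<Longrightarrow> r w0 * p (t @ z') = r (w0 @ LX # LQ # t) * p z'"
    "\<And>t. r (w0 @ LX # LQ # t) \<noteq> 0 \<Longrightarrow> length t + N = length z0 \<Longrightarrow>
      (\<exists>v. t = LQ # LX # LX # v) \<and> double t"
proof -
  \<comment> \<open>The sum may be restricted to any finite set holding all contributing pairs; the
    arguments below supply sets of at most two pairs.\<close>
  have total': "(\<Sum>(w, z)\<in>S. r w * p z * pairing w z y) = of_bool (y = [])"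
    if "finite S" and "\<And>w z. r w \<noteq> 0 \<Longrightarrow> p z \<noteq> 0 \<Longrightarrow> pairing w z y \<noteq> (0 :: 'f) \<Longrightarrow> (w, z) \<in> S"
    for S y
  proof -
    have zero: "r w * p z * pairing w z y = 0" if "(w, z) \<notin> S" for w z
      using that \<open>\<And>w z. _ \<Longrightarrow> _ \<Longrightarrow> _ \<Longrightarrow> (w, z) \<in> S\<close>[of w z] by auto
    have "(\<Sum>(w, z)\<in>S. r w * p z * pairing w z y) =
      (\<Sum>(w, z)\<in>{w. r w \<noteq> 0} \<times> {z. p z \<noteq> 0}. r w * p z * pairing w z y)"
      using that(1) fin_r fin_p zero by (intro sum.mono_neutral_cong) (auto, blast)
    then show ?thesis by (simp add: total flip: sum.cartesian_product)
  qed
  have pairing_cases: "\<not> double w \<and> y = w @ LX # LQ # z \<or> double w \<and> strong z \<and> y = w @ z"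
    if "r w \<noteq> 0" "p z \<noteq> 0" "pairing w z y \<noteq> (0 :: 'f)"
      and "\<not> double w \<Longrightarrow> length w + length z < length y" for w z y
    using that r[of w] p[of z]
    by (cases "double w"; cases "strong z")
      (simp_all add: pairing_single pairing_double_strong pairing_double_weak)

  \<comment> \<open>Double words contribute nothing to the coefficient of the empty word, which has
    to be 1.\<close>
  have "\<exists>w. r w \<noteq> 0 \<and> \<not> double w"
  proof (rule ccontr)
    assume double: "\<nexists>w. r w \<noteq> 0 \<and> \<not> double w"
    have "pairing w z [] = (0 :: 'f)" if "r w \<noteq> 0" "p z \<noteq> 0" for w z
    proof (rule ccontr)
      assume "pairing w z [] \<noteq> (0 :: 'f)"
      then show False using pairing_cases[of w z "[]"] double that by (auto simp: double_def)
    qed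
    then show False using total'[of "{}" "[]"] by auto
  qed
  then obtain w0 where w0: "r w0 \<noteq> 0" "\<not> double w0"
    and w0_max: "\<And>w. r w \<noteq> 0 \<Longrightarrow> \<not> double w \<Longrightarrow> length w \<le> length w0"
    using exists_longest[of "\<lambda>w. r w \<noteq> 0 \<and> \<not> double w"] fin_r by force
  have "\<exists>z. p z \<noteq> 0" using total'[of "{}" "[]"] by auto
  then obtain z0 where z0: "p z0 \<noteq> 0" and z0_max: "\<And>z. p z \<noteq> 0 \<Longrightarrow> length z \<le> length z0"
    using exists_longest[of "\<lambda>z. p z \<noteq> 0"] fin_p by blast
  \<comment> \<open>This is the length of \<open>w0 x q z0\<close>; from here on only leading words
    contribute.\<close>
  let ?L = "length w0 + length z0 + 2"
  have long: "\<not> double w \<and> y = w @ LX # LQ # z \<or> double w \<and> strong z \<and> y = w @ z"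
    if "r w \<noteq> 0" "p z \<noteq> 0" "pairing w z y \<noteq> (0 :: 'f)" "length y \<ge> ?L" for w z y
    using w0_max[of w] z0_max[of z] that by (intro pairing_cases) simp_all

  \<comment> \<open>Another word of the form \<open>w x q z'\<close> with \<open>w\<close> not
    double cannot cancel this one: maximality of both lengths forces the same factorisation.\<close>
  have partner: "\<exists>w' z'. r w' \<noteq> 0 \<and> p z' \<noteq> 0 \<and> double w' \<and> strong z' \<and> w0 @ LX # LQ # z = w' @ z'"
    if z: "p z \<noteq> 0" "length z = length z0" for z
  proof (rule ccontr)
    let ?y = "w0 @ LX # LQ # z"
    assume none: "\<not> ?thesis"
    have "(w, z') \<in> {(w0, z)}"
      if wz: "r w \<noteq> 0" "p z' \<noteq> 0" "pairing w z' ?y \<noteq> (0 :: 'f)" for w z'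
    proof -
      have eq: "?y = w @ LX # LQ # z'" and "\<not> double w"
        using long[OF wz] none wz(1,2) z(2) by auto
      have "length w = length w0"
        using w0_max[OF wz(1) \<open>\<not> double w\<close>] z0_max[OF wz(2)] z(2) arg_cong[OF eq, of length] by simp
      then show ?thesis using eq by auto
    qed
    then have "r w0 * p z * pairing w0 z ?y = 0" using total'[of "{(w0, z)}" ?y] by auto
    moreover have "pairing w0 z ?y = (- 1 :: 'f)"
      using w0 z r[of w0] p[of z] by (simp add: pairing_single)
    ultimately show False using w0 z by simp
  qed

  obtain w1 where w1: "r w1 \<noteq> 0" "double w1"
    and w1_max: "\<And>w. r w \<noteq> 0 \<Longrightarrow> double w \<Longrightarrow> length w \<le> length w1"
    using exists_longest[of "\<lambda>w. r w \<noteq> 0 \<and> double w"] fin_r partner[OF z0] by force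
  obtain z1 where z1: "p z1 \<noteq> 0" "strong z1"
    and z1_max: "\<And>z. p z \<noteq> 0 \<Longrightarrow> strong z \<Longrightarrow> length z \<le> length z1"
    using exists_longest[of "\<lambda>z. p z \<noteq> 0 \<and> strong z"] fin_p partner[OF z0] by force
  \<comment> \<open>A longer word \<open>w1 @ z1\<close> would have nothing to cancel
    against.\<close>
  have "length w1 + length z1 \<le> ?L"
  proof (rule ccontr)
    let ?y = "w1 @ z1"
    assume gt: "\<not> ?thesis"
    have "(w, z) \<in> {(w1, z1)}"
      if wz: "r w \<noteq> 0" "p z \<noteq> 0" "pairing w z ?y \<noteq> (0 :: 'f)" for w z
    proof -
      have "?y = w @ z \<and> double w \<and> strong z"
      proof (rule ccontr)
        assume "\<not> ?thesis"
        then have eq: "?y = w @ LX # LQ # z" and "\<not> double w"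
          using long[OF wz] gt by auto
        show False
          using w0_max[OF wz(1)] z0_max[OF wz(2)] gt \<open>\<not> double w\<close> arg_cong[OF eq, of length] by simp
      qed
      moreover from this have "length w = length w1"
        using w1_max[OF wz(1)] z1_max[OF wz(2)] by (metis add_le_cancel_left add_le_cancel_right antisym_conv length_append)
      ultimately show ?thesis by auto
    qed
    then have "r w1 * p z1 * pairing w1 z1 ?y = 0"
      using total'[of "{(w1, z1)}" ?y] w1 by (auto simp: double_def)
    then show False using w1 z1 r[of w1] p[of z1] by (simp add: pairing_double_strong)
  qed
  moreover have "?L \<le> length w1 + length z1"
  proof -
    obtain w' z' where wz: "r w' \<noteq> 0" "p z' \<noteq> 0" "double w'" "strong z'"
      and eq: "w0 @ LX # LQ # z0 = w' @ z'" using partner[OF z0] by blast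
    show ?thesis using w1_max[OF wz(1,3)] z1_max[OF wz(2,4)] arg_cong[OF eq, of length] by simp
  qed
  ultimately have L: "length w1 + length z1 = ?L" by simp

  have factor: "length z1 < length z0 \<and>
      (\<exists>t z'. z = t @ z' \<and> length z' = length z1 \<and> strong z' \<and> p z' \<noteq> 0 \<and> r (w0 @ LX # LQ # t) \<noteq> 0)"
    if z: "p z \<noteq> 0" "length z = length z0" for z
  proof -
    obtain w' z' where wz: "r w' \<noteq> 0" "p z' \<noteq> 0" "double w'" "strong z'"
      and eq: "(w0 @ [LX, LQ]) @ z = w' @ z'" using partner[OF z] by auto
    have len: "length w' = length w1 \<and> length z' = length z1"
      using w1_max[OF wz(1,3)] z1_max[OF wz(2,4)] arg_cong[OF eq, of length] L z by simp
    \<comment> \<open>As \<open>z'\<close> is no longer than \<open>z\<close>, the word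
      \<open>w'\<close> extends \<open>w0 x q\<close>; equality is excluded because a double word
      does not end with \<open>q\<close>.\<close>
    have "\<exists>t. t \<noteq> [] \<and> w' = w0 @ LX # LQ # t \<and> z = t @ z'"
    proof -
      consider (1) us where "w0 @ [LX, LQ] = w' @ us" "us @ z = z'"
        | (2) us where "w' = (w0 @ [LX, LQ]) @ us" "z = us @ z'"
        using eq unfolding append_eq_append_conv2 by metis
      then show ?thesis
      proof cases
        case 1
        with z0_max[OF wz(2)] z have "us = []" by auto
        with 1 have "last w' = LQ" by (metis append_Nil2 last.simps last_appendR list.distinct(1))
        with wz(3) show ?thesis by (auto simp: double_def)
      next
        case 2
        have "us \<noteq> []"
        proof
          assume "us = []"
          with 2 have "last w' = LQ" by simp
          with wz(3) show False by (auto simp: double_def)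
        qed
        with 2 show ?thesis by auto
      qed
    qed
    then obtain t where t: "t \<noteq> []" "w' = w0 @ LX # LQ # t" "z = t @ z'" by blast
    then have "length z' < length z" by simp
    with t wz len z show ?thesis by auto
  qed

  have len_double: "double w" if "r w \<noteq> 0" "length w > length w0" for w
    using w0_max[of w] that by force
  \<comment> \<open>Exactly two pairs can reach the word \<open>w0 x q t z'\<close>, and they do so
    with opposite signs.\<close>
  have ratio: "r w0 * p (t @ z') = r (w0 @ LX # LQ # t) * p z'"
    if t: "r (w0 @ LX # LQ # t) \<noteq> 0" and z': "p z' \<noteq> 0" "strong z'" "length z' = length z1"
      and len: "length t + length z1 = length z0" for t z'
  proof -
    let ?w = "w0 @ LX # LQ # t" and ?y = "w0 @ LX # LQ # t @ z'"
    have "(w, z) \<in> {(w0, t @ z'), (?w, z')}"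
      if wz: "r w \<noteq> 0" "p z \<noteq> 0" "pairing w z ?y \<noteq> (0 :: 'f)" for w z
    proof (cases "double w")
      case False
      then have eq: "?y = w @ LX # LQ # z"
        using long[OF wz] len z'(3) by auto
      have "length w = length w0"
        using w0_max[OF wz(1) False] z0_max[OF wz(2)] len z' arg_cong[OF eq, of length] by simp
      then show ?thesis using eq by auto
    next
      case True
      then have eq: "?w @ z' = w @ z" and "strong z"
        using long[OF wz] len z'(3) by auto
      have "length ?w = length w"
        using w1_max[OF wz(1) True] z1_max[OF wz(2) \<open>strong z\<close>] len z' L arg_cong[OF eq, of length] by simp
      with eq have "?w = w \<and> z' = z" using append_eq_append_conv by blast
      then show ?thesis by blast
    qed
    then have "(\<Sum>(w, z)\<in>{(w0, t @ z'), (?w, z')}. r w * p z * pairing w z ?y) = of_bool (?y = [])"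
      by (intro total') auto
    then have "r w0 * p (t @ z') * pairing w0 (t @ z') ?y + r ?w * p z' * pairing ?w z' ?y = 0"
      by simp
    \<comment> \<open>The factor \<open>p (t @ z')\<close> is kept because \<open>t @ z'\<close> is
      known to be normal only where this factor is nonzero.\<close>
    moreover have "p (t @ z') * pairing w0 (t @ z') ?y = - p (t @ z')"
      using w0 r[of w0] p[of "t @ z'"] by (cases "p (t @ z') = 0") (auto simp: pairing_single)
    moreover have "pairing ?w z' ?y = (1 :: 'f)"
      using len_double[OF t] t z' r[of ?w] p[of z'] by (simp add: pairing_double_strong)
    ultimately show ?thesis by (simp add: mult.assoc)
  qed

  have shape: "(\<exists>v. t = LQ # LX # LX # v) \<and> double t"
    if t: "r (w0 @ LX # LQ # t) \<noteq> 0" and len: "length t + length z1 = length z0" for t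
  proof -
    have "t \<noteq> []" using factor[OF z0] len by auto
    have ends: "ends_x t" using r[OF t] \<open>t \<noteq> []\<close> by (simp add: ends_x_def)
    have red: "reduced (LX # LQ # t)" using r[OF t] reduced_appendD by blast
    obtain u where u: "w0 @ LX # LQ # t = u @ [LX, LX]"
      using len_double[OF t] by (auto simp: double_def)
    \<comment> \<open>The ratio puts \<open>t @ z1\<close> into the support of \<open>p\<close>;
      being longer than \<open>z1\<close> it is not strong, so \<open>t\<close> cannot start with
      \<open>qq\<close>.\<close>
    have "p (t @ z1) \<noteq> 0" using ratio[OF t z1 refl len] t z1 by auto
    then have "\<not> strong (t @ z1)" using z1_max[of "t @ z1"] \<open>t \<noteq> []\<close> by auto
    show ?thesis
    proof (cases t rule: two_letters_cases)
      case (qx v)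
      have "double t"
      proof -
        obtain us where "us @ t = [LX, LX] \<or> t = us @ [LX, LX]"
          using u append_eq_append_conv2[of "w0 @ [LX, LQ]" t u "[LX, LX]"] by auto
        with qx show ?thesis by (auto simp: double_def append_eq_Cons_conv)
      qed
      then have "v \<noteq> []" using qx by (auto simp: double_def append_eq_Cons_conv)
      with red qx have "\<exists>v'. v = LX # v'" by (cases v; cases "hd v") auto
      with \<open>double t\<close> qx show ?thesis by auto
    qed (use \<open>t \<noteq> []\<close> ends red \<open>\<not> strong (t @ z1)\<close> in \<open>auto simp: ends_x_def strong_def\<close>)
  qed
  show ?thesis
    by (rule that[of w0 z0 "length z1"])
      (use w0 z0 z0_max z1_max factor[OF z0] factor ratio shape in auto)
qed

lemma length_less_uminus: "a \<in> length_less n \<Longrightarrow> - a \<in> length_less n"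
proof (induction rule: length_less.induct)
  case (monomial m c)
  have "monomial c m + monomial (- c) m = 0" by (simp flip: monomial_add)
  then have "- monomial c m = monomial (- c) m" by (rule minus_unique)
  with monomial show ?case by (simp add: length_less.monomial)
next
  case (add a b)
  then show ?case using length_less.add[of "- a" n "- b"] by simp
qed (simp add: length_less.zero)

lemma length_less_diff: "a \<in> length_less n \<Longrightarrow> b \<in> length_less n \<Longrightarrow> a - b \<in> length_less n"
  using length_less.add[of a n "- b"] length_less_uminus[of b n] by simp

section \<open>Infinite descent\<close>

text \<open>Descent on the length bound for \<open>p\<close>; \<open>a\<close> is generalised
  because every descent step alters both factors.\<close>

lemma coidem_product_noncongruent_1:
  fixes a p :: "'f::field ginv_alg"
  assumes "p \<in> length_less n"
  shows "a * coidem * p - 1 \<notin> left_ideal_x"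
  using assms
proof (induction n arbitrary: a p rule: less_induct)
  case (less n)
  show ?case
  proof
    assume mem: "a * coidem * p - 1 \<in> left_ideal_x"
    obtain f where fin_f: "finite {z. f z \<noteq> 0}"
      and f: "\<forall>z. f z \<noteq> 0 \<longrightarrow> reduced z \<and> ends_q z \<and> starts_q z \<and> length z < n"
      and p_f: "coidem * (p - lin f) \<in> left_ideal_x"
      using left_normal_form[OF less.prems] by blast
    obtain r where fin_r: "finite {w. r w \<noteq> 0}"
      and r: "\<forall>w. r w \<noteq> 0 \<longrightarrow> reduced w \<and> ends_x w"
      and a_r: "a * coidem = lin r * coidem"
      using right_normal_form[of a] by blast
    \<comment> \<open>The left factor is replaced exactly, the right one only modulo
      \<open>Sx\<close>, which left multiplication by \<open>a\<close> preserves.\<close>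
    have "lin r * coidem * lin f - 1 = (a * coidem * p - 1) - a * (coidem * (p - lin f))"
      unfolding a_r[symmetric] by (simp add: algebra_simps)
    then have mem': "lin r * coidem * lin f - 1 \<in> left_ideal_x"
      by (simp only: left_ideal_x_diff[OF mem left_ideal_x_mult[OF p_f]])
    have total: "(\<Sum>w | r w \<noteq> 0. \<Sum>z | f z \<noteq> 0. r w * f z * pairing w z y) = of_bool (y = [])" for y
    proof -
      have "coeff y (lin r * coidem * lin f) = coeff y (1 :: 'f ginv_alg)"
        using coeff_left_ideal_x[OF mem', of y] by (simp add: coeff_diff)
      also have "\<dots> = of_bool (y = [])"
        by (auto simp: coeff_monomial simp flip: monomial_Nil)
      finally show ?thesis by (simp add: coeff_lin_coidem_lin)
    qed
    obtain w0 z0 N where w0: "r w0 \<noteq> 0" and z0: "f z0 \<noteq> 0"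
      and z0_max: "\<And>z. f z \<noteq> 0 \<Longrightarrow> length z \<le> length z0" and N: "N < length z0"
      and N_max: "\<And>z. f z \<noteq> 0 \<Longrightarrow> strong z \<Longrightarrow> length z \<le> N"
      and factor: "\<And>z. f z \<noteq> 0 \<Longrightarrow> length z = length z0 \<Longrightarrow>
        \<exists>t z'. z = t @ z' \<and> length z' = N \<and> strong z' \<and> f z' \<noteq> 0 \<and> r (w0 @ LX # LQ # t) \<noteq> 0"
      and ratio: "\<And>t z'. r (w0 @ LX # LQ # t) \<noteq> 0 \<Longrightarrow> f z' \<noteq> 0 \<Longrightarrow> strong z' \<Longrightarrow> length z' = N \<Longrightarrow>
        length t + N = length z0 \<Longrightarrow> r w0 * f (t @ z') = r (w0 @ LX # LQ # t) * f z'"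
      and shape: "\<And>t. r (w0 @ LX # LQ # t) \<noteq> 0 \<Longrightarrow> length t + N = length z0 \<Longrightarrow>
        (\<exists>v. t = LQ # LX # LX # v) \<and> double t"
      by (rule leading_cancellation[OF fin_r fin_f _ _ total]) (use r f in auto)

    \<comment> \<open>The sum \<open>k\<close> below is the left quotient of the longest part of
      \<open>lin f\<close> by its strong part of length \<open>N\<close>; \<open>\<rho> t\<close> is
      the common ratio \<open>f (t @ z') / f z'\<close>.\<close>
    define T where "T = {t. r (w0 @ LX # LQ # t) \<noteq> 0 \<and> length t + N = length z0}"
    define \<rho> where "\<rho> t = r (w0 @ LX # LQ # t) / r w0" for t
    define k where "k = (\<Sum>t\<in>T. monomial (\<rho> t) t)"
    have "finite ((\<lambda>t. w0 @ LX # LQ # t) -` {w. r w \<noteq> 0})"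
      using fin_r by (intro finite_vimageI) (auto simp: inj_def)
    then have fin_T: "finite T" by (rule rev_finite_subset) (auto simp: T_def)
    have T_double: "\<exists>u. t = u @ [LX, LX]" and T_weak: "\<exists>v. t = LQ # LX # LX # v" if "t \<in> T" for t
      using shape[of t] that by (auto simp: T_def double_def)
    \<comment> \<open>The collision \<open>xxqxx = xxx = 0\<close> gives both
      \<open>k * k = 0\<close> and the vanishing of \<open>k\<close> on nonempty words that are not
      strong.\<close>
    have absorb: "monomial c (t @ LQ # LX # LX # v) = 0" if "t \<in> T" for c :: 'f and t v
      using T_double[OF that] monomial_xqx[of c "_ @ [LX]" "LX # v"] by (auto simp: monomial_xxx)
    have k_coidem: "k * coidem = k"
      unfolding k_def sum_distrib_right
      by (intro sum.cong refl) (use T_double monomial_xx_coidem in fastforce)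
    have k_k: "k * k = 0"
      unfolding k_def sum_product
      by (intro sum.neutral ballI) (use T_weak absorb in \<open>force simp: monomial_mult\<close>)

    define p' where "p' = lin f - k * lin f"
    define a' where "a' = lin r * (1 + coidem * k)"
    \<comment> \<open>Since \<open>k * coidem = k\<close>, the two middle terms cancel and the last
      one becomes \<open>coidem * (k * k)\<close>.\<close>
    have "(1 + coidem * k) * coidem * (1 - k) = coidem - coidem * k + coidem * (k * coidem)
        - coidem * (k * coidem) * k"
      by (simp add: algebra_simps)
    also have "\<dots> = coidem" using k_k by (simp add: k_coidem mult.assoc)
    finally have transvection: "(1 + coidem * k) * coidem * (1 - k) = coidem" .
    have "a' * coidem * p' = lin r * ((1 + coidem * k) * coidem * (1 - k)) * lin f"
      by (simp add: a'_def p'_def algebra_simps)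
    then have a'_p': "a' * coidem * p' - 1 \<in> left_ideal_x"
      using mem' by (simp add: transvection)

    define top where "top = {z. f z \<noteq> 0 \<and> length z = length z0}"
    define bot where "bot = {z. f z \<noteq> 0 \<and> length z < length z0}"
    define S1 where "S1 = {z. f z \<noteq> 0 \<and> strong z \<and> length z = N}"
    define S2 where "S2 = {z. f z \<noteq> 0 \<and> strong z \<and> length z < N}"
    define S3 where "S3 = {z. f z \<noteq> 0 \<and> \<not> strong z}"
    have fin: "finite top" "finite bot" "finite S1" "finite S2" "finite S3"
      unfolding top_def bot_def S1_def S2_def S3_def by (rule rev_finite_subset[OF fin_f]; auto)+
    define prod where "prod A = (\<Sum>t\<in>T. \<Sum>z\<in>A. monomial (\<rho> t * f z) (t @ z))" for A

    have f_T: "f (t @ z) = \<rho> t * f z" if "t \<in> T" "z \<in> S1" for t z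
      using ratio[of t z] that w0 by (simp add: T_def S1_def \<rho>_def field_simps)
    \<comment> \<open>All words of \<open>T\<close> have the same length, so the splitting is
      unique; \<open>factor\<close> provides its existence.\<close>
    have "bij_betw (\<lambda>(t, z). t @ z) (T \<times> S1) top"
      unfolding bij_betw_def
    proof
      show "inj_on (\<lambda>(t, z). t @ z) (T \<times> S1)"
        by (auto simp: inj_on_def T_def S1_def)
      have "f (t @ z) \<noteq> 0" if "t \<in> T" "z \<in> S1" for t z
        using f_T[OF that] that w0 by (simp add: T_def S1_def \<rho>_def)
      moreover have "z \<in> (\<lambda>(t, z). t @ z) ` (T \<times> S1)" if "z \<in> top" for z
        using factor[of z] that by (force simp: top_def T_def S1_def)
      ultimately show "(\<lambda>(t, z). t @ z) ` (T \<times> S1) = top"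
        by (auto simp: top_def) (auto simp: T_def S1_def)
    qed
    then have "(\<Sum>z\<in>top. monomial (f z) z) = (\<Sum>(t, z)\<in>T \<times> S1. monomial (f (t @ z)) (t @ z))"
      by (subst sum.reindex_bij_betw[symmetric]) (auto simp: case_prod_unfold)
    also have "\<dots> = (\<Sum>(t, z)\<in>T \<times> S1. monomial (\<rho> t * f z) (t @ z))"
      by (intro sum.cong refl) (auto simp: f_T)
    also have "\<dots> = prod S1" by (simp add: prod_def sum.cartesian_product)
    finally have top_eq: "(\<Sum>z\<in>top. monomial (f z) z) = prod S1" .

    have "lin f = (\<Sum>z\<in>top \<union> bot. monomial (f z) z)"
      unfolding lin_def by (rule sum.cong) (use z0_max[unfolded le_less] in \<open>auto simp: top_def bot_def\<close>)
    also have "\<dots> = prod S1 + (\<Sum>z\<in>bot. monomial (f z) z)"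
      using fin by (subst sum.union_disjoint) (auto simp: top_eq, auto simp: top_def bot_def)
    finally have lin_f: "lin f = prod S1 + (\<Sum>z\<in>bot. monomial (f z) z)" .

    have "k * lin f = prod {z. f z \<noteq> 0}"
      by (simp add: k_def lin_def prod_def sum_product monomial_mult)
    also have "{z. f z \<noteq> 0} = S1 \<union> (S2 \<union> S3)"
      using N_max[unfolded le_less] by (auto simp: S1_def S2_def S3_def)
    also have "prod (S1 \<union> (S2 \<union> S3)) = prod S1 + (prod S2 + prod S3)"
    proof -
      have disj: "S1 \<inter> (S2 \<union> S3) = {}" "S2 \<inter> S3 = {}" by (auto simp: S1_def S2_def S3_def)
      show ?thesis using fin disj by (simp add: prod_def sum.union_disjoint sum.distrib)
    qed
    finally have k_lin_f: "k * lin f = prod S1 + (prod S2 + prod S3)" .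

    \<comment> \<open>In \<open>p'\<close> the longest part of \<open>lin f\<close> cancels against
      \<open>prod S1\<close>. Dropping \<open>prod S3\<close>, which lies in \<open>Sx\<close>,
      leaves only words shorter than \<open>z0\<close>.\<close>
    define p'' where "p'' = (\<Sum>z\<in>bot. monomial (f z) z) - prod S2"
    have p''_eq: "p'' = p' + prod S3"
      by (simp add: p''_def p'_def lin_f k_lin_f[unfolded lin_f])
    have "prod S2 \<in> length_less (length z0)"
      unfolding prod_def by (intro length_less_sum length_less.monomial) (auto simp: T_def S2_def)
    then have p'': "p'' \<in> length_less (length z0)"
      unfolding p''_def
      by (intro length_less_diff length_less_sum length_less.monomial) (auto simp: bot_def)
    have "monomial c (t @ z) \<in> left_ideal_x" if t: "t \<in> T" and z: "z \<in> S3" for c :: 'f and t z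
    proof -
      have "reduced z" "ends_q z" "starts_q z" "\<not> strong z" using z f by (auto simp: S3_def)
      then show ?thesis
      proof (cases rule: not_strong_cases)
        case 1
        obtain u where "t = u @ [LX, LX]" using T_double[OF t] by blast
        with 1 show ?thesis using monomial_snoc_x[of c "u @ [LX]"] by simp
      next
        case (2 v)
        then show ?thesis using absorb[OF t, of c v] left_ideal_x_0 by simp
      qed
    qed
    then have "prod S3 \<in> left_ideal_x"
      unfolding prod_def by (intro left_ideal_x_sum)
    then have "a' * coidem * p' - 1 + a' * coidem * prod S3 \<in> left_ideal_x"
      using a'_p' by (intro left_ideal_x_add left_ideal_x_mult)
    then have "a' * coidem * p'' - 1 \<in> left_ideal_x"
      by (simp add: p''_eq algebra_simps)
    moreover have "length z0 < n" using f z0 by blast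
    ultimately show False using less.IH p'' by blast
  qed
qed

theorem theorem2p1:
  shows "is_nilpotent (S_x :: 'f::field ginv_alg)
    \<and> vn_regular (S_x :: 'f ginv_alg)
    \<and> \<not> unit_regular (S_x :: 'f ginv_alg)"
proof (intro conjI notI)
  show "is_nilpotent (S_x :: 'f ginv_alg)"
    unfolding is_nilpotent_def by (rule exI[of _ 3]) (simp add: power3_eq_cube S_x_cubed)
  show "vn_regular (S_x :: 'f ginv_alg)"
    unfolding vn_regular_def inner_inverse_def by (rule exI[of _ S_q]) (simp add: S_xqx)
  assume "unit_regular (S_x :: 'f ginv_alg)"
  then obtain u v :: "'f ginv_alg" where xux: "S_x * u * S_x = S_x" and uv: "u * v = 1"
    unfolding unit_regular_def inner_inverse_def ring_unit_def by metis
  \<comment> \<open>From \<open>xux = x\<close> it follows that \<open>1 - x u\<close> annihilates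
    \<open>xq\<close>, so it absorbs \<open>coidem\<close>.\<close>
  have "S_x * u * (S_x * S_q) = S_x * S_q" by (simp add: xux flip: mult.assoc)
  then have "(1 - S_x * u) * coidem = 1 - S_x * u"
    by (simp add: coidem_def algebra_simps)
  then have "u * (1 - S_x * u) * coidem * v = u * (1 - S_x * u) * v"
    by (simp add: mult.assoc)
  also have "\<dots> = 1 - u * S_x" using uv by (simp add: algebra_simps)
  finally have "u * (1 - S_x * u) * coidem * v - 1 = (- u) * S_x" by simp
  then have "u * (1 - S_x * u) * coidem * v - 1 \<in> left_ideal_x"
    unfolding left_ideal_x_def by (rule range_eqI)
  then show False
    using coidem_product_noncongruent_1 length_less_exhausts by blast
qed

end
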